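(* For each $\alpha$ with $0<\alpha<1/2$ there is a Hölder $\alpha$ graph $\Gamma\subset\mathbb{R}^2$ which is not quasiconformally removable in $\mathbb{R}^2$.
   Context: A Hölder $\alpha$ graph is the graph $\{(x,f(x)):x\in[0,1]\}\subset\mathbb{R}^2$ of a function $f:[0,1]\to\mathbb{R}$ satisfying $|f(x)-f(y)|\le C|x-y|^\alpha$ for all $x,y\in[0,1]$, for some constant $C$. A map $f:\Omega\to\tilde\Omega$ between open subsets of $\mathbb{R}^2$ is quasiconformal if it is a homeomorphism, is absolutely continuous on almost every line parallel to the coordinate axes (ACL; i.e. on almost every such line, absolutely continuous on each compact segment of the line contained in $\Omega$), is differentiable almost everywhere, and there is a constant $C$ such that $\max_\theta|\partial_\theta f(x)|\le C\min_\theta|\partial_\theta f(x)|$ for almost every $x\in\Omega$, where the max and min are over all directions $\theta$ and $\partial_\theta$ is the directional derivative. A compact set $K\subset\mathbb{R}^2$ is quasiconformally removable in $\mathbb{R}^2$ if every homeomorphism of $\mathbb{R}^2$ which is quasiconformal on $\mathbb{R}^2\setminus K$ (as a map onto its image) is quasiconformal on $\mathbb{R}^2$. *)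

theory Defs
  imports "HOL-Analysis.Analysis"
begin

definition holder_graph :: "real \<Rightarrow> (real \<times> real) set \<Rightarrow> bool" where
  "holder_graph \<alpha> \<Gamma> \<longleftrightarrow>
     (\<exists>f :: real \<Rightarrow> real.
        (\<exists>C. \<forall>x\<in>{0..1}. \<forall>y\<in>{0..1}. \<bar>f x - f y\<bar> \<le> C * \<bar>x - y\<bar> powr \<alpha>) \<and>
        \<Gamma> = (\<lambda>x. (x, f x)) ` {0..1})"

(* A finite family of non-overlapping compact intervals is given as the set D of the pairs of
   their endpoints; only the open intervals have to be disjoint, endpoints may be shared. *)
definition absolutely_continuous_on :: "real set \<Rightarrow> (real \<Rightarrow> 'a::metric_space) \<Rightarrow> bool" where
  "absolutely_continuous_on S f \<longleftrightarrow>
     (\<forall>\<epsilon>>0. \<exists>\<delta>>0. \<forall>D.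
        finite D \<and> (\<forall>(u, v)\<in>D. u \<le> v \<and> {u..v} \<subseteq> S) \<and>
        pairwise (\<lambda>I J. disjnt {fst I<..<snd I} {fst J<..<snd J}) D \<and>
        (\<Sum>(u, v)\<in>D. v - u) < \<delta>
        \<longrightarrow> (\<Sum>(u, v)\<in>D. dist (f u) (f v)) < \<epsilon>)"

definition ACL_on :: "(real \<times> real) set \<Rightarrow> (real \<times> real \<Rightarrow> 'a::metric_space) \<Rightarrow> bool" where
  "ACL_on \<Omega> f \<longleftrightarrow>
     (AE y in lebesgue. \<forall>a b. a \<le> b \<and> {a..b} \<times> {y} \<subseteq> \<Omega> \<longrightarrow>
        absolutely_continuous_on {a..b} (\<lambda>x. f (x, y))) \<and>
     (AE x in lebesgue. \<forall>a b. a \<le> b \<and> {x} \<times> {a..b} \<subseteq> \<Omega> \<longrightarrow>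
        absolutely_continuous_on {a..b} (\<lambda>y. f (x, y)))"

definition dir_deriv ::
    "real \<Rightarrow> (real \<times> real \<Rightarrow> 'a::real_normed_vector) \<Rightarrow> real \<times> real \<Rightarrow> 'a" where
  "dir_deriv \<theta> f p = vector_derivative (\<lambda>t. f (p + t *\<^sub>R (cos \<theta>, sin \<theta>))) (at 0)"

(* Where f is differentiable, the norm of dir_deriv is a continuous periodic function of the
   angle, so the supremum and infimum below are attained. *)
definition quasiconformal ::
    "(real \<times> real) set \<Rightarrow> (real \<times> real) set \<Rightarrow> (real \<times> real \<Rightarrow> real \<times> real) \<Rightarrow> bool" where
  "quasiconformal \<Omega> \<Omega>' f \<longleftrightarrow>
     open \<Omega> \<and> open \<Omega>' \<and> (\<exists>g. homeomorphism \<Omega> \<Omega>' f g) \<and>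
     ACL_on \<Omega> f \<and>
     (AE p in lebesgue. p \<in> \<Omega> \<longrightarrow> f differentiable (at p)) \<and>
     (\<exists>C. AE p in lebesgue. p \<in> \<Omega> \<longrightarrow>
        (SUP \<theta>. norm (dir_deriv \<theta> f p)) \<le> C * (INF \<theta>. norm (dir_deriv \<theta> f p)))"

(* Meant for compact K. Compactness is not a conjunct, so that negating the predicate really
   asserts the existence of a homeomorphism violating the implication. *)
definition qc_removable :: "(real \<times> real) set \<Rightarrow> bool" where
  "qc_removable K \<longleftrightarrow>
     (\<forall>f g. homeomorphism UNIV UNIV f g \<and> quasiconformal (- K) (f ` (- K)) f
        \<longrightarrow> quasiconformal UNIV UNIV f)"

lemma compact_holder_graph:
  assumes "0 < \<alpha>" and "holder_graph \<alpha> \<Gamma>"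
  shows "compact \<Gamma>"
proof -
  obtain f C where C: "\<And>x y. x \<in> {0..1} \<Longrightarrow> y \<in> {0..1} \<Longrightarrow> \<bar>f x - f y\<bar> \<le> C * \<bar>x - y\<bar> powr \<alpha>"
    and \<Gamma>: "\<Gamma> = (\<lambda>x. (x, f x)) ` {0..1::real}"
    using assms(2) unfolding holder_graph_def by blast
  have "continuous_on {0..1} f"
    unfolding continuous_on_def
  proof
    fix x :: real assume x: "x \<in> {0..1}"
    have "((\<lambda>y. C * \<bar>y - x\<bar> powr \<alpha>) \<longlongrightarrow> C * \<bar>x - x\<bar> powr \<alpha>) (at x within {0..1})"
      using assms(1) by (intro tendsto_intros tendsto_powr') auto
    then have "((\<lambda>y. C * \<bar>y - x\<bar> powr \<alpha>) \<longlongrightarrow> 0) (at x within {0..1})"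
      by simp
    moreover have "\<forall>\<^sub>F y in at x within {0..1}. norm (f y - f x) \<le> C * \<bar>y - x\<bar> powr \<alpha>"
      using C x by (auto simp: eventually_at_filter)
    ultimately have "((\<lambda>y. f y - f x) \<longlongrightarrow> 0) (at x within {0..1})"
      by (rule Lim_null_comparison[rotated])
    then show "(f \<longlongrightarrow> f x) (at x within {0..1})"
      by (simp add: Lim_null[symmetric])
  qed
  then show ?thesis
    unfolding \<Gamma> by (intro compact_continuous_image continuous_intros) auto
qed

end

theory Submission
  imports Defs
begin

text \<open>
  The homeomorphism is a shear \<open>F (x, y) = (x + u x y, y)\<close>. The function \<open>u\<close> is to be continuous,
  nondecreasing in \<open>x\<close>, uniformly Lipschitz in \<open>y\<close>, and locally independent of \<open>x\<close> off a graph
  \<open>\<Gamma>\<close> of a function \<open>f\<close>. Then \<open>F\<close> is locally bilipschitz off \<open>\<Gamma>\<close>, hence quasiconformal there; but if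
  on the horizontal lines through \<open>\<Gamma>\<close> the function \<open>u\<close> climbs like the Cantor function, \<open>F\<close> is not
  ACL on the plane. One should think of \<open>u x y\<close> as the local time that \<open>f\<close> has spent at the
  level \<open>y\<close> up to the time \<open>x\<close>.

  To construct \<open>u\<close>, start from the hat function with support \<open>[0, 2]\<close>. It is the average of its
  \<open>n\<^sup>2\<close> translates scaled by \<open>1 / n\<close> and multiplied by \<open>n\<close> (lemma \<open>hat_refinement\<close>). Write each of
  these twice with half the height: a hat is then a sum of \<open>2 n\<^sup>2\<close> hats that are \<open>n\<close> times narrower
  and \<open>2 n\<close> times lower, so that the slopes are halved. Iterate this, and add the hats one after
  another, in the time steps of an interval \<open>[0, 1]\<close> divided into \<open>4 n\<^sup>2\<close> equal parts, again and
  again, where every second part is left idle. The sum of what was added before the time \<open>x\<close> is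
  \<open>u x\<close> (called \<open>gain x\<close> below). Since the slopes decay geometrically, \<open>u x\<close> is Lipschitz
  (\<open>partial_lipschitz\<close>, \<open>gain_lipschitz\<close>). For every \<open>y\<close>, the function \<open>u\<close> only grows on the Cantor
  set of times that are never idle; this set has length zero (\<open>card_active\<close>), so \<open>u\<close> is not absolutely
  continuous in \<open>x\<close> whenever \<open>hat y > 0\<close> (\<open>not_absolutely_continuous_shear\<close>).

  On that Cantor set, \<open>f x\<close> is the place where hats are being added at the time \<open>x\<close>. Two active times
  which are separated at the \<open>l\<close>-th division have a distance of at least \<open>(4 n\<^sup>2) ^ -l\<close>, because of
  the idle parts, and the corresponding places have a distance of order at most \<open>n ^ -l\<close>
  (\<open>position_separation\<close>). So \<open>f\<close> is Hoelder of exponent \<open>\<alpha>\<close> if \<open>(4 n\<^sup>2) powr \<alpha> \<le> n\<close>, and for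
  \<open>\<alpha> < 1 / 2\<close> this holds for all large \<open>n\<close>. McShane's formula extends \<open>f\<close> to the line without loss.
  Near a point off the graph no hat narrower than some scale is ever added, so \<open>u\<close> is there a finite
  sum of hats in the variable \<open>y\<close> alone (\<open>gain_locally_partial\<close>).
\<close>

section \<open>Absolute continuity, directional derivatives and Hoelder extension\<close>

lemma lipschitz_imp_absolutely_continuous_on:
  assumes lip: "\<And>x y. x \<in> S \<Longrightarrow> y \<in> S \<Longrightarrow> dist (f x) (f y) \<le> K * \<bar>x - y\<bar>"
  shows "absolutely_continuous_on S f"
  unfolding absolutely_continuous_on_def
proof (intro allI impI)
  fix \<epsilon> :: real assume \<epsilon>: "\<epsilon> > 0"
  define M where "M = \<bar>K\<bar> + 1"
  have M: "M > 0" "K \<le> M" by (auto simp: M_def)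
  show "\<exists>\<delta>>0. \<forall>D. finite D \<and> (\<forall>(u, v)\<in>D. u \<le> v \<and> {u..v} \<subseteq> S) \<and>
        pairwise (\<lambda>I J. disjnt {fst I<..<snd I} {fst J<..<snd J}) D \<and>
        (\<Sum>(u, v)\<in>D. v - u) < \<delta> \<longrightarrow> (\<Sum>(u, v)\<in>D. dist (f u) (f v)) < \<epsilon>"
  proof (intro exI[of _ "\<epsilon> / M"] conjI allI impI)
    show "\<epsilon> / M > 0" using \<epsilon> M by simp
    fix D assume D: "finite D \<and> (\<forall>(u, v)\<in>D. u \<le> v \<and> {u..v} \<subseteq> S) \<and>
        pairwise (\<lambda>I J. disjnt {fst I<..<snd I} {fst J<..<snd J}) D \<and>
        (\<Sum>(u, v)\<in>D. v - u) < \<epsilon> / M"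
    have "(\<Sum>(u, v)\<in>D. dist (f u) (f v)) \<le> (\<Sum>(u, v)\<in>D. M * (v - u))"
    proof (rule sum_mono, clarify)
      fix u v assume "(u, v) \<in> D"
      then have uv: "u \<le> v" "{u..v} \<subseteq> S" using D by auto
      then have "dist (f u) (f v) \<le> K * \<bar>u - v\<bar>" by (intro lip) auto
      also have "\<dots> \<le> M * (v - u)" using uv M by (intro mult_mono) auto
      finally show "dist (f u) (f v) \<le> M * (v - u)" .
    qed
    also have "\<dots> = M * (\<Sum>(u, v)\<in>D. v - u)"
      by (simp add: sum_distrib_left case_prod_unfold)
    also have "\<dots> < \<epsilon>" using D M by (simp add: field_simps)
    finally show "(\<Sum>(u, v)\<in>D. dist (f u) (f v)) < \<epsilon>" .
  qed
qed

lemma dir_deriv_eq: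
  assumes "(f has_derivative f') (at p)"
  shows "dir_deriv \<theta> f p = f' (cos \<theta>, sin \<theta>)"
proof -
  let ?v = "(cos \<theta>, sin \<theta>)"
  have "((\<lambda>t. p + t *\<^sub>R ?v) has_derivative (\<lambda>t. t *\<^sub>R ?v)) (at 0)"
    by (auto intro!: derivative_eq_intros)
  moreover have "(f has_derivative f') (at (p + 0 *\<^sub>R ?v))" using assms by (simp del: scaleR_Pair)
  ultimately have "((\<lambda>t. f (p + t *\<^sub>R ?v)) has_derivative (\<lambda>t. f' (t *\<^sub>R ?v))) (at 0)"
    by (rule has_derivative_compose[of "\<lambda>t. p + t *\<^sub>R ?v" "\<lambda>t. t *\<^sub>R ?v" 0 UNIV f f'])
  moreover have "f' (t *\<^sub>R ?v) = t *\<^sub>R f' ?v" for t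
    using assms by (simp add: has_derivative_def bounded_linear.linear linear_scale del: scaleR_Pair)
  ultimately have "((\<lambda>t. f (p + t *\<^sub>R ?v)) has_vector_derivative f' ?v) (at 0)"
    by (simp only: has_vector_derivative_def)
  then show ?thesis unfolding dir_deriv_def by (rule vector_derivative_at)
qed

lemma powr_add_le_add_powr:
  fixes a b p :: real
  assumes "0 \<le> a" "0 \<le> b" "0 < p" "p \<le> 1"
  shows "(a + b) powr p \<le> a powr p + b powr p"
proof (cases "a + b = 0")
  case True
  then show ?thesis using assms by (auto simp: add_nonneg_eq_0_iff)
next
  case False
  then have s: "a + b > 0" using assms by simp
  have le: "x / (a + b) \<le> (x / (a + b)) powr p" if "0 \<le> x" "x \<le> a + b" for x
    using powr_mono'[of p 1 "x / (a + b)"] that s assms by simp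
  have "1 = a / (a + b) + b / (a + b)" using s by (simp add: add_divide_distrib[symmetric])
  also have "\<dots> \<le> (a / (a + b)) powr p + (b / (a + b)) powr p"
    using assms by (intro add_mono le) auto
  also have "\<dots> = (a powr p + b powr p) / (a + b) powr p"
    using assms s by (simp add: powr_divide add_divide_distrib)
  finally show ?thesis using s by (simp add: field_simps)
qed

text \<open>McShane's extension, for values prescribed along an indexed family of points. That coinciding
  points carry the same value is part of the Hoelder condition.\<close>

lemma holder_extension:
  fixes e v :: "'i \<Rightarrow> real"
  assumes \<alpha>: "0 < \<alpha>" "\<alpha> \<le> 1" and C: "0 \<le> C"
    and hol: "\<And>i j. i \<in> I \<Longrightarrow> j \<in> I \<Longrightarrow> \<bar>v i - v j\<bar> \<le> C * \<bar>e i - e j\<bar> powr \<alpha>"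
  obtains f where "\<And>x y. \<bar>f x - f y\<bar> \<le> C * \<bar>x - y\<bar> powr \<alpha>" "\<And>i. i \<in> I \<Longrightarrow> f (e i) = v i"
proof (cases "I = {}")
  case True
  show ?thesis by (rule that[of "\<lambda>_. 0"]) (use C True in auto)
next
  case False
  define F where "F x i = v i + C * \<bar>x - e i\<bar> powr \<alpha>" for x i
  define f where "f x = (INF i\<in>I. F x i)" for x
  have tri: "C * \<bar>x - z\<bar> powr \<alpha> \<le> C * \<bar>x - y\<bar> powr \<alpha> + C * \<bar>y - z\<bar> powr \<alpha>" for x y z
  proof -
    have "\<bar>x - z\<bar> powr \<alpha> \<le> (\<bar>x - y\<bar> + \<bar>y - z\<bar>) powr \<alpha>"
      using \<alpha> by (intro powr_mono2) auto
    also have "\<dots> \<le> \<bar>x - y\<bar> powr \<alpha> + \<bar>y - z\<bar> powr \<alpha>"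
      using \<alpha> by (intro powr_add_le_add_powr) auto
    finally show ?thesis using C by (metis distrib_left mult_left_mono)
  qed
  have below: "v j - C * \<bar>x - e j\<bar> powr \<alpha> \<le> F x i" if "i \<in> I" "j \<in> I" for x i j
    using hol[OF that(2,1)] tri[of "e j" "e i" x] unfolding F_def
    by (simp add: abs_minus_commute)
  have bdd: "bdd_below (F x ` I)" for x
    using False below by (meson bdd_belowI2 ex_in_conv)
  have le: "f x \<le> f y + C * \<bar>x - y\<bar> powr \<alpha>" for x y
  proof -
    have "f x - C * \<bar>x - y\<bar> powr \<alpha> \<le> f y"
      unfolding f_def[of y]
    proof (rule cINF_greatest[OF False])
      fix i assume "i \<in> I"
      then have "f x \<le> F x i" unfolding f_def by (intro cINF_lower bdd)
      also have "\<dots> \<le> F y i + C * \<bar>x - y\<bar> powr \<alpha>"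
        using tri[of x "e i" y] unfolding F_def by simp
      finally show "f x - C * \<bar>x - y\<bar> powr \<alpha> \<le> F y i" by simp
    qed
    then show ?thesis by simp
  qed
  show ?thesis
  proof (rule that[of f])
    show "\<bar>f x - f y\<bar> \<le> C * \<bar>x - y\<bar> powr \<alpha>" for x y
      using le[of x y] le[of y x] by (simp add: abs_minus_commute abs_le_iff)
    show "f (e i) = v i" if "i \<in> I" for i
    proof (rule antisym)
      have "f (e i) \<le> F (e i) i" unfolding f_def using that by (intro cINF_lower bdd)
      then show "f (e i) \<le> v i" using \<alpha> by (simp add: F_def)
      show "v i \<le> f (e i)"
        unfolding f_def using below[OF _ that, of _ "e i"] \<alpha> by (intro cINF_greatest[OF False]) auto
    qed
  qed
qed

section \<open>The hat function and its refinement equation\<close>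

lemma sum_lessThan_mult:
  fixes h :: "nat \<Rightarrow> 'a::comm_monoid_add"
  shows "(\<Sum>i<m * k. h i) = (\<Sum>q<m. \<Sum>r<k. h (q * k + r))"
proof -
  have "(\<Sum>r<k. h (q * k + r)) = sum h {q * k..<q * k + k}" for q
    using sum.shift_bounds_nat_ivl[of h 0 "q * k" k] by (simp add: atLeast0LessThan add.commute)
  then show ?thesis by (simp add: sum.nat_group)
qed

text \<open>The piecewise linear function that is \<open>0\<close> off \<open>[0, 2]\<close> and \<open>1\<close> at \<open>1\<close>, written as the second
  difference of the ramp \<open>max 0\<close>, for which sums of translates telescope.\<close>

definition hat :: "real \<Rightarrow> real" where
  "hat y = max 0 y - 2 * max 0 (y - 1) + max 0 (y - 2)"

lemma hat_nonneg: "0 \<le> hat y" and hat_le_1: "hat y \<le> 1"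
  by (auto simp: hat_def max_def)

lemma hat_eq_0: "y \<le> 0 \<or> 2 \<le> y \<Longrightarrow> hat y = 0"
  by (auto simp: hat_def max_def)

lemma hat_lipschitz: "\<bar>hat x - hat y\<bar> \<le> \<bar>x - y\<bar>"
  by (auto simp: hat_def max_def)

lemma hat_differentiable:
  assumes "y \<notin> \<rat>"
  shows "hat differentiable (at y)"
proof -
  have ne: "y \<noteq> 0" "y \<noteq> 1" "y \<noteq> 2" using assms by auto
  have ramp: "(\<lambda>y. max 0 (y - c)) differentiable (at y)" if "y \<noteq> c" for c :: real
  proof (cases "y < c")
    case True
    have "((\<lambda>y. max 0 (y - c)) has_derivative (\<lambda>_. 0)) (at y)"
      by (rule has_derivative_transform_within_open[where f = "\<lambda>_. 0" and s = "{..<c}"]) (use True in auto)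
    then show ?thesis by (auto simp: differentiable_def)
  next
    case False
    have "((\<lambda>y. max 0 (y - c)) has_derivative (\<lambda>h. h)) (at y)"
      by (rule has_derivative_transform_within_open[where f = "\<lambda>y. y - c" and s = "{c<..}"])
         (use False that in \<open>auto intro!: derivative_eq_intros\<close>)
    then show ?thesis by (auto simp: differentiable_def)
  qed
  have "(\<lambda>y. max 0 (y - 0) - 2 * max 0 (y - 1) + max 0 (y - 2)) differentiable (at y)"
    by (intro differentiable_add differentiable_diff differentiable_mult differentiable_const ramp ne)
  then show ?thesis by (simp add: hat_def[abs_def])
qed

text \<open>The hat is the convolution of two boxes, and a box is a disjoint union of \<open>n\<close> boxes of
  \<open>1 / n\<close> times its length; hence the uniform weights.\<close>

lemma hat_refinement:
  assumes "0 < n"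
  shows "(\<Sum>a<n. \<Sum>b<n. hat (real n * y - real (a + b))) = real n * hat y"
proof -
  define s where "s x = max 0 x - max 0 (x - 1)" for x :: real
  define x where "x = real n * y"
  have hat_s: "hat x = s x - s (x - 1)" for x by (simp add: hat_def s_def algebra_simps)
  have inner: "(\<Sum>b<n. hat (z - real b)) = s z - s (z - real n)" for z
    using sum_lessThan_telescope'[of "\<lambda>b. s (z - real b)" n] by (simp add: hat_s algebra_simps)
  have outer: "(\<Sum>a<n. s (z - real a)) = max 0 z - max 0 (z - real n)" for z
    using sum_lessThan_telescope'[of "\<lambda>a. max 0 (z - real a)" n]
    by (simp add: s_def diff_diff_eq add.commute)
  have "(\<Sum>b<n. hat (x - real (a + b))) = s (x - real a) - s (x - real n - real a)" for a
    using inner[of "x - real a"] by (simp add: diff_diff_eq add.commute)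
  then have "(\<Sum>a<n. \<Sum>b<n. hat (x - real (a + b))) = (\<Sum>a<n. s (x - real a) - s (x - real n - real a))"
    by simp
  also have "\<dots> = (max 0 x - max 0 (x - real n)) - (max 0 (x - real n) - max 0 (x - 2 * real n))"
    using outer[of x] outer[of "x - real n"] by (simp add: sum_subtractf)
  also have "\<dots> = real n * hat y"
  proof -
    have *: "max 0 (real n * y - c * real n) = real n * max 0 (y - c)" for c
      using assms by (simp add: max_mult_distrib_left algebra_simps)
    from *[of 0] *[of 1] *[of 2] show ?thesis
      by (simp add: hat_def x_def algebra_simps)
  qed
  finally show ?thesis by (simp add: x_def)
qed

section \<open>Iterated refinement\<close>

text \<open>Throughout, \<open>n\<close> is the factor by which the hats get narrower from one level to the next.\<close>

locale refinement =
  fixes n :: nat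
  assumes n_ge_2: "2 \<le> n"
begin

text \<open>The number of parts into which a time interval is divided. The \<open>j\<close>-th time interval of level \<open>k\<close>
  goes from \<open>j / base ^ k\<close> to \<open>(j + 1) / base ^ k\<close>; those that lie in it at the next level are
  numbered \<open>j * base + i\<close> with \<open>i < base\<close>.\<close>

definition base :: nat where "base = n * n * 4"

text \<open>The digits \<open>i < base\<close> encode triples \<open>(a, b, s)\<close> by \<open>i = (a * n + b) * 4 + s\<close>, where \<open>a, b < n\<close>
  and \<open>s < 4\<close>. The hat that belongs to such a digit is the translate by \<open>a + b\<close>; the digits with
  \<open>s = 0\<close> and \<open>s = 2\<close>, which are the even ones, are active, and the odd ones are idle.\<close>

definition offset :: "nat \<Rightarrow> nat" where "offset i = i div 4 div n + i div 4 mod n"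

text \<open>During the \<open>j\<close>-th time interval of level \<open>k\<close> a hat is added that has the support
  \<open>[position k j / n ^ k, (position k j + 2) / n ^ k]\<close> and the height \<open>height k j\<close>. The height is
  zero if one of the digits is idle, and also for \<open>j \<ge> base ^ k\<close>, that is, after the time \<open>1\<close>.\<close>

primrec position :: "nat \<Rightarrow> nat \<Rightarrow> nat" where
  "position 0 j = 0"
| "position (Suc k) j = n * position k (j div base) + offset (j mod base)"

primrec height :: "nat \<Rightarrow> nat \<Rightarrow> real" where
  "height 0 j = (if j = 0 then 1 else 0)"
| "height (Suc k) j = height k (j div base) * (if even j then 1 / (2 * real n) else 0)"

definition bump :: "nat \<Rightarrow> nat \<Rightarrow> real \<Rightarrow> real" where
  "bump k j y = height k j * hat (real n ^ k * y - real (position k j))"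

text \<open>What has been added by the time \<open>i / base ^ k\<close>, as computed with the hats of level \<open>k\<close>.\<close>

definition partial :: "nat \<Rightarrow> nat \<Rightarrow> real \<Rightarrow> real" where
  "partial k i y = (\<Sum>j<i. bump k j y)"

lemma base_pos: "0 < base" and even_base: "even base"
  using n_ge_2 by (auto simp: base_def)

lemma base_ge_2: "2 \<le> base"
  using n_ge_2 mult_le_mono[of 2 n 2 n] by (simp add: base_def)

lemma height_nonneg: "0 \<le> height k j"
  by (induction k arbitrary: j) auto

lemma height_le: "height k j \<le> (1 / (2 * real n)) ^ k"
proof (induction k arbitrary: j)
  case (Suc k)
  show ?case
    using mult_right_mono[OF Suc[of "j div base"], of "1 / (2 * real n)"] by (auto simp: mult.commute)
qed auto

lemma height_cases: "height k j = 0 \<or> height k j = (1 / (2 * real n)) ^ k"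
proof (induction k arbitrary: j)
  case (Suc k)
  show ?case using Suc[of "j div base"] by (auto simp: mult.commute)
qed auto

lemma height_eq_0: "base ^ k \<le> j \<Longrightarrow> height k j = 0"
proof (induction k arbitrary: j)
  case (Suc k)
  have "base ^ k \<le> j div base"
    using Suc.prems base_pos by (simp add: less_eq_div_iff_mult_less_eq mult.commute)
  then show ?case using Suc.IH by simp
qed auto

lemma bump_nonneg: "0 \<le> bump k j y"
  by (simp add: bump_def height_nonneg hat_nonneg)

lemma bump_le: "bump k j y \<le> (1 / (2 * real n)) ^ k"
  using mult_mono[OF height_le[of k j] hat_le_1[of "real n ^ k * y - real (position k j)"]] hat_nonneg
  by (simp add: bump_def)

lemma bump_lipschitz: "\<bar>bump k j y - bump k j z\<bar> \<le> (1 / 2) ^ k * \<bar>y - z\<bar>"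
proof -
  have "\<bar>bump k j y - bump k j z\<bar> = height k j *
      \<bar>hat (real n ^ k * y - real (position k j)) - hat (real n ^ k * z - real (position k j))\<bar>"
    by (simp add: bump_def right_diff_distrib[symmetric] abs_mult height_nonneg)
  also have "\<dots> \<le> (1 / (2 * real n)) ^ k * \<bar>real n ^ k * y - real n ^ k * z\<bar>"
    using hat_lipschitz[of "real n ^ k * y - real (position k j)" "real n ^ k * z - real (position k j)"]
    by (intro mult_mono height_le) auto
  also have "\<dots> = (1 / 2) ^ k * \<bar>y - z\<bar>"
    using n_ge_2 by (simp add: right_diff_distrib[symmetric] abs_mult power_divide power_mult_distrib)
  finally show ?thesis .
qed

text \<open>Every pair \<open>(a, b)\<close> belongs to exactly two active digits.\<close>

lemma sum_digits:
  "(\<Sum>i<base. (if even i then 1 / (2 * real n) else 0) * g (offset i)) = (\<Sum>a<n. \<Sum>b<n. g (a + b)) / real n"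
proof -
  have four: "(\<Sum>r<4. h r) = h 0 + h 1 + h 2 + h (3::nat)" for h :: "nat \<Rightarrow> real"
    by (simp add: eval_nat_numeral)
  have "(\<Sum>i<base. (if even i then 1 / (2 * real n) else 0) * g (offset i))
      = (\<Sum>m<n * n. g (m div n + m mod n) / real n)"
  proof -
    have "offset (q * 4) = q div n + q mod n" "offset (q * 4 + 2) = q div n + q mod n" for q
    proof -
      have "q * 4 div 4 = q" "(q * 4 + 2) div 4 = q" by simp_all
      then show "offset (q * 4) = q div n + q mod n" "offset (q * 4 + 2) = q div n + q mod n"
        by (simp_all only: offset_def)
    qed
    then show ?thesis
      unfolding base_def sum_lessThan_mult[of _ "n * n"] four by simp
  qed
  also have "\<dots> = (\<Sum>a<n. \<Sum>b<n. g (a + b) / real n)"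
    unfolding sum_lessThan_mult by (intro sum.cong) auto
  finally show ?thesis by (simp add: sum_divide_distrib)
qed

lemma bump_refinement: "(\<Sum>i<base. bump (Suc k) (q * base + i) y) = bump k q y"
proof -
  define x where "x = real n ^ k * y - real (position k q)"
  have n: "real n > 0" using n_ge_2 by simp
  have "(\<Sum>i<base. bump (Suc k) (q * base + i) y)
      = height k q * (\<Sum>i<base. (if even i then 1 / (2 * real n) else 0) * hat (real n * x - real (offset i)))"
    unfolding sum_distrib_left
  proof (rule sum.cong)
    fix i assume "i \<in> {..<base}"
    then show "bump (Suc k) (q * base + i) y
      = height k q * ((if even i then 1 / (2 * real n) else 0) * hat (real n * x - real (offset i)))"
      using even_base by (simp add: bump_def x_def algebra_simps)
  qed simp
  also have "\<dots> = height k q * hat x"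
    using n hat_refinement[of n x] n_ge_2 sum_digits[of "\<lambda>a. hat (real n * x - real a)"] by simp
  finally show ?thesis by (simp add: bump_def x_def)
qed

lemma partial_0 [simp]: "partial k 0 y = 0"
  by (simp add: partial_def)

lemma partial_Suc: "partial k (Suc i) y = partial k i y + bump k i y"
  by (simp add: partial_def)

lemma partial_mono: "i \<le> j \<Longrightarrow> partial k i y \<le> partial k j y"
  unfolding partial_def by (intro sum_mono2) (auto simp: bump_nonneg)

text \<open>The partial sums at the same time agree, whatever the level is.\<close>

lemma partial_refinement: "partial (Suc k) (i * base) y = partial k i y"
  unfolding partial_def sum_lessThan_mult by (simp add: bump_refinement)

lemma partial_refinement_power: "partial (k + m) (i * base ^ m) y = partial k i y"
proof (induction m)
  case (Suc m)
  then show ?case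
    using partial_refinement[of "k + m" "i * base ^ m" y] by (simp add: mult_ac)
qed simp

lemma partial_0_1: "partial 0 1 y = hat y"
  by (simp add: partial_def bump_def)

lemma partial_ge: "base ^ k \<le> i \<Longrightarrow> partial k i y = hat y"
proof -
  assume "base ^ k \<le> i"
  then have "partial k i y = partial k (base ^ k) y"
    unfolding partial_def by (intro sum.mono_neutral_right) (auto simp: bump_def height_eq_0)
  then show ?thesis using partial_refinement_power[of 0 k 1 y] partial_0_1 by simp
qed

text \<open>The slopes of the level \<open>k\<close> bumps are at most \<open>2 ^ -k\<close>, and between two consecutive multiples
  of \<open>base\<close> only fewer than \<open>base\<close> of them are added; so the slopes of all partial sums are bounded.\<close>

lemma partial_lipschitz: "\<bar>partial k i y - partial k i z\<bar> \<le> 2 * real base * \<bar>y - z\<bar>"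
proof -
  have "\<bar>partial k i y - partial k i z\<bar> \<le> real base * (2 - (1 / 2) ^ k) * \<bar>y - z\<bar>"
  proof (induction k arbitrary: i)
    case 0
    have "partial 0 i = (if i = 0 then (\<lambda>_. 0) else hat)" using partial_ge[of 0 i] by (auto simp: fun_eq_iff)
    moreover have "1 * \<bar>y - z\<bar> \<le> real base * \<bar>y - z\<bar>"
      using base_ge_2 by (intro mult_right_mono) auto
    ultimately show ?case using hat_lipschitz[of y z] by auto
  next
    case (Suc k)
    define q r where "q = i div base" and "r = i mod base"
    have i: "i = q * base + r" and r: "r \<le> base" using base_pos by (auto simp: q_def r_def less_imp_le)
    have eq: "partial (Suc k) i w = partial k q w + (\<Sum>j<r. bump (Suc k) (q * base + j) w)" for w
    proof -
      have "partial (Suc k) i w = partial (Suc k) (q * base) w + (\<Sum>j<r. bump (Suc k) (q * base + j) w)"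
        unfolding i partial_def by (induction r) auto
      then show ?thesis by (simp add: partial_refinement)
    qed
    have "\<bar>partial (Suc k) i y - partial (Suc k) i z\<bar> \<le> \<bar>partial k q y - partial k q z\<bar>
        + \<bar>\<Sum>j<r. bump (Suc k) (q * base + j) y - bump (Suc k) (q * base + j) z\<bar>"
      unfolding eq sum_subtractf by linarith
    also have "\<bar>\<Sum>j<r. bump (Suc k) (q * base + j) y - bump (Suc k) (q * base + j) z\<bar>
        \<le> (\<Sum>j<r. (1 / 2) ^ Suc k * \<bar>y - z\<bar>)"
      by (rule order_trans[OF sum_abs]) (intro sum_mono bump_lipschitz)
    also have "\<dots> \<le> real base * ((1 / 2) ^ Suc k * \<bar>y - z\<bar>)"
      using r by (simp add: mult_right_mono)
    also have "\<bar>partial k q y - partial k q z\<bar> \<le> real base * (2 - (1 / 2) ^ k) * \<bar>y - z\<bar>"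
      by (rule Suc.IH)
    finally show ?case by (simp add: algebra_simps)
  qed
  also have "\<dots> \<le> 2 * real base * \<bar>y - z\<bar>" by (intro mult_right_mono) (auto simp: algebra_simps)
  finally show ?thesis .
qed

lemma partial_differentiable:
  assumes "y \<notin> \<rat>"
  shows "partial k i differentiable (at y)"
proof -
  have "bump k j differentiable (at y)" for j
  proof -
    have nr: "real n ^ k * y - real (position k j) \<notin> \<rat>"
    proof
      assume "real n ^ k * y - real (position k j) \<in> \<rat>"
      then have "(real n ^ k * y - real (position k j) + real (position k j)) / real n ^ k \<in> \<rat>"
        by (intro Rats_divide Rats_add) auto
      then show False using assms n_ge_2 by simp
    qed
    have "(hat \<circ> (\<lambda>y. real n ^ k * y - real (position k j))) differentiable (at y)"
      by (intro differentiable_chain_at differentiable_diff differentiable_mult differentiable_ident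
          differentiable_const hat_differentiable nr)
    then show ?thesis
      unfolding bump_def[abs_def] by (intro differentiable_mult) (auto simp: o_def)
  qed
  then show ?thesis unfolding partial_def[abs_def] by (intro differentiable_sum) auto
qed


section \<open>The limit function\<close>

text \<open>The quantity \<open>partial k i y\<close> depends only on \<open>y\<close> and on the time \<open>i / base ^ k\<close>, and it is nondecreasing
  in that time; \<open>gain\<close> extends it to all real times. It is constant outside \<open>[0, 1]\<close>; on the
  negative times this is due to the truncation by \<open>max 0\<close>.\<close>

definition gain :: "real \<Rightarrow> real \<Rightarrow> real" where
  "gain t y = Sup {partial k i y | k i. real i \<le> real base ^ k * max 0 t}"

lemma partial_le_partial:
  assumes "real i / real base ^ k \<le> real j / real base ^ m"
  shows "partial k i y \<le> partial m j y"
proof -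
  have "real (i * base ^ m) \<le> real (j * base ^ k)"
    using assms base_pos by (simp add: field_simps)
  then have "i * base ^ m \<le> j * base ^ k" by (simp only: of_nat_le_iff)
  then have "partial (k + m) (i * base ^ m) y \<le> partial (m + k) (j * base ^ k) y"
    by (simp add: partial_mono add.commute)
  then show ?thesis by (simp only: partial_refinement_power)
qed

lemma gain_nonempty: "{partial k i y |k i. real i \<le> real base ^ k * max 0 t} \<noteq> {}"
proof -
  have "real 0 \<le> real base ^ 0 * max 0 t" by simp
  then show ?thesis by blast
qed

lemma partial_le_hat: "partial k i y \<le> hat y"
  using partial_mono[of i "max i (base ^ k)" k y] partial_ge[of k "max i (base ^ k)" y] by simp

lemma gain_ge: "real i \<le> real base ^ k * max 0 t \<Longrightarrow> partial k i y \<le> gain t y"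
  unfolding gain_def
  by (rule cSup_upper) (auto intro!: bdd_aboveI[of _ "hat y"] partial_le_hat)

lemma gain_le:
  assumes "real base ^ k * max 0 t \<le> real i"
  shows "gain t y \<le> partial k i y"
  unfolding gain_def
proof (rule cSup_least)
  show "{partial k i y |k i. real i \<le> real base ^ k * max 0 t} \<noteq> {}" by (rule gain_nonempty)
next
  fix z assume "z \<in> {partial k i y |k i. real i \<le> real base ^ k * max 0 t}"
  then obtain m j where z: "z = partial m j y" "real j \<le> real base ^ m * max 0 t" by blast
  have "real j / real base ^ m \<le> max 0 t" using z base_pos by (simp add: field_simps)
  also have "\<dots> \<le> real i / real base ^ k" using divide_right_mono[OF assms, of "real base ^ k"] base_pos by simp
  finally show "z \<le> partial k i y" unfolding z by (rule partial_le_partial)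
qed

lemma gain_eq_partial: "gain (real i / real base ^ k) y = partial k i y"
proof -
  have "real base ^ k * max 0 (real i / real base ^ k) = real i" using base_pos by (simp add: max_absorb2)
  then show ?thesis
    using gain_ge[of i k "real i / real base ^ k" y] gain_le[of k "real i / real base ^ k" i y] by simp
qed

lemma gain_nonneg: "0 \<le> gain t y"
  using gain_ge[of 0 0 t y] by simp

lemma gain_le_hat: "gain t y \<le> hat y"
  using gain_le[of 0 t "nat \<lceil>max 0 t\<rceil>" y] partial_le_hat[of 0 "nat \<lceil>max 0 t\<rceil>" y]
  by (simp add: real_nat_ceiling_ge)

lemma gain_nonpos: "t \<le> 0 \<Longrightarrow> gain t y = 0"
  using gain_le[of 0 t 0 y] gain_nonneg[of t y] by simp

lemma gain_ge_1: "1 \<le> t \<Longrightarrow> gain t y = hat y"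
  using gain_ge[of 1 0 t y] gain_le_hat[of t y] partial_0_1[of y] by simp

lemma gain_mono:
  assumes "s \<le> t"
  shows "gain s y \<le> gain t y"
  unfolding gain_def[of s]
proof (rule cSup_least)
  show "{partial k i y |k i. real i \<le> real base ^ k * max 0 s} \<noteq> {}" by (rule gain_nonempty)
next
  fix z assume "z \<in> {partial k i y |k i. real i \<le> real base ^ k * max 0 s}"
  then obtain m j where z: "z = partial m j y" "real j \<le> real base ^ m * max 0 s" by blast
  have "real base ^ m * max 0 s \<le> real base ^ m * max 0 t"
    using assms by (intro mult_left_mono) auto
  then show "z \<le> gain t y" unfolding z(1) using z(2) by (intro gain_ge) linarith
qed

lemma gain_lipschitz: "\<bar>gain t y - gain t z\<bar> \<le> 2 * real base * \<bar>y - z\<bar>"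
proof -
  have "gain t y \<le> gain t z + 2 * real base * \<bar>y - z\<bar>" for y z
    unfolding gain_def[of t y]
  proof (rule cSup_least)
    show "{partial k i y |k i. real i \<le> real base ^ k * max 0 t} \<noteq> {}" by (rule gain_nonempty)
    fix w assume "w \<in> {partial k i y |k i. real i \<le> real base ^ k * max 0 t}"
    then obtain m j where w: "w = partial m j y" "real j \<le> real base ^ m * max 0 t" by blast
    show "w \<le> gain t z + 2 * real base * \<bar>y - z\<bar>"
      unfolding w(1) using gain_ge[OF w(2), of z] partial_lipschitz[of m j y z] by linarith
  qed
  from this[of y z] this[of z y] show ?thesis by (simp add: abs_le_iff abs_minus_commute)
qed

text \<open>Two points at a distance of at most \<open>base ^ -k\<close> lie in the union of two adjacent time
  intervals of level \<open>k\<close>, each of which contributes at most the height of one hat.\<close>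

lemma gain_oscillation:
  assumes "\<bar>s - t\<bar> \<le> 1 / real base ^ k"
  shows "\<bar>gain s y - gain t y\<bar> \<le> 2 * (1 / (2 * real n)) ^ k"
proof -
  have "gain t y - gain s y \<le> 2 * (1 / (2 * real n)) ^ k"
    if st: "s \<le> t" "t \<le> s + 1 / real base ^ k" for s t
  proof -
    define i where "i = nat \<lfloor>real base ^ k * max 0 s\<rfloor>"
    have i: "real i \<le> real base ^ k * max 0 s" "real base ^ k * max 0 s < real i + 1"
      by (simp_all add: i_def)
    have "real base ^ k * max 0 t \<le> real base ^ k * (max 0 s + 1 / real base ^ k)"
      using st by (intro mult_left_mono) auto
    also have "\<dots> = real base ^ k * max 0 s + 1" using base_pos by (simp add: algebra_simps)
    finally have "real base ^ k * max 0 t \<le> real (Suc (Suc i))" using i by simp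
    from gain_le[OF this, of y] gain_ge[OF i(1), of y] show ?thesis
      using bump_le[of k i y] bump_le[of k "Suc i" y] by (simp add: partial_Suc)
  qed
  from this[of s t] this[of t s] gain_mono[of s t y] gain_mono[of t s y] assms
  show ?thesis by (cases "s \<le> t") (auto simp: abs_if split: if_splits)
qed

lemma continuous_on_gain: "continuous_on UNIV (\<lambda>p. gain (fst p) (snd p))"
  unfolding continuous_on_iff
proof (intro ballI allI impI)
  fix p :: "real \<times> real" and \<epsilon> :: real assume \<epsilon>: "0 < \<epsilon>"
  have "1 / (2 * real n) < 1" using n_ge_2 by simp
  then obtain k where k: "(1 / (2 * real n)) ^ k < \<epsilon> / 4"
    using real_arch_pow_inv[of "\<epsilon> / 4" "1 / (2 * real n)"] \<epsilon> by auto
  define \<delta> where "\<delta> = min (1 / real base ^ k) (\<epsilon> / (4 * real base))"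
  have "gain (fst q) (snd q) \<in> ball (gain (fst p) (snd p)) \<epsilon>" if q: "dist q p < \<delta>" for q
  proof -
    have "\<bar>fst q - fst p\<bar> < \<delta>" "\<bar>snd q - snd p\<bar> < \<delta>"
      using q dist_fst_le[of q p] dist_snd_le[of q p] by (auto simp: dist_real_def)
    then have 1: "\<bar>fst q - fst p\<bar> \<le> 1 / real base ^ k" and 2: "\<bar>snd q - snd p\<bar> < \<epsilon> / (4 * real base)"
      by (auto simp: \<delta>_def)
    have "2 * real base * \<bar>snd q - snd p\<bar> < \<epsilon> / 2"
      using 2 base_pos by (simp add: field_simps)
    with gain_oscillation[OF 1, of "snd q"] gain_lipschitz[of "fst p" "snd q" "snd p"] k
    show ?thesis by (simp add: dist_real_def)
  qed
  moreover have "0 < \<delta>" using \<epsilon> base_pos by (simp add: \<delta>_def)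
  ultimately show "\<exists>d>0. \<forall>q\<in>UNIV. dist q p < d \<longrightarrow> dist (gain (fst q) (snd q)) (gain (fst p) (snd p)) < \<epsilon>"
    by (auto simp: dist_commute)
qed

section \<open>The homeomorphism\<close>

text \<open>The homeomorphism of the plane that violates removability.\<close>

definition shear :: "real \<times> real \<Rightarrow> real \<times> real" where
  "shear p = (fst p + gain (fst p) (snd p), snd p)"

lemma continuous_on_shear: "continuous_on UNIV shear"
  unfolding shear_def[abs_def] by (intro continuous_intros continuous_on_gain)

lemma inj_shear: "inj shear"
proof (rule injI)
  fix p q assume eq: "shear p = shear q"
  then have "snd p = snd q" and e: "fst p + gain (fst p) (snd q) = fst q + gain (fst q) (snd q)"
    by (auto simp: shear_def)
  moreover have "fst p = fst q"
    using e gain_mono[of "fst p" "fst q" "snd q"] gain_mono[of "fst q" "fst p" "snd q"]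
    by linarith
  ultimately show "p = q" by (simp add: prod_eq_iff)
qed

lemma surj_shear: "surj shear"
proof -
  have "(a, y) \<in> range shear" for a y
  proof -
    have "continuous_on {a - 1..a} ((\<lambda>p. fst (shear p)) \<circ> (\<lambda>x. (x, y)))"
      by (intro continuous_on_compose continuous_intros continuous_on_subset[OF continuous_on_shear]) auto
    then have "continuous_on {a - 1..a} (\<lambda>x. x + gain x y)" by (simp add: o_def shear_def)
    moreover have "a - 1 + gain (a - 1) y \<le> a" "a \<le> a + gain a y"
      using gain_le_hat[of "a - 1" y] hat_le_1[of y] gain_nonneg[of a y] by auto
    ultimately obtain x where "x + gain x y = a"
      using IVT'[of "\<lambda>x. x + gain x y" "a - 1" a a] by auto
    then show ?thesis by (intro image_eqI[of _ _ "(x, y)"]) (auto simp: shear_def)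
  qed
  then show ?thesis by auto
qed

lemma homeomorphism_shear: obtains g where "homeomorphism UNIV UNIV shear g"
  using invariance_of_domain_homeomorphism[OF open_UNIV continuous_on_shear _ inj_shear] surj_shear
  by auto

section \<open>The Hoelder function\<close>

lemma height_neq_0_even: "height (Suc k) j \<noteq> 0 \<Longrightarrow> height k (j div base) \<noteq> 0 \<and> even j"
  by (auto split: if_splits)

lemma offset_le:
  assumes "i < base"
  shows "offset i \<le> 2 * n - 2"
proof -
  have "i div 4 < n * n" using assms by (simp add: base_def less_mult_imp_div_less)
  then have "i div 4 div n < n" by (simp add: less_mult_imp_div_less)
  moreover have "i div 4 mod n < n" using n_ge_2 by simp
  ultimately show ?thesis unfolding offset_def by linarith
qed

text \<open>Here \<open>k - l\<close> is the level at which the two time intervals get separated. The induction needs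
  the slightly stronger bounds with \<open>+ 1\<close> and \<open>- 4\<close>: active digits are at most \<open>base - 2\<close>, so passing
  to the next level maps a distance \<open>d\<close> of times to at least \<open>d * base - (base - 2)\<close>, while a
  distance \<open>d\<close> of places grows to at most \<open>n * d + 2 * n - 2\<close>.\<close>

lemma position_separation:
  assumes "height k i \<noteq> 0" "height k j \<noteq> 0" "i \<noteq> j"
  shows "\<exists>l<k. int base ^ l + 1 \<le> \<bar>int i - int j\<bar> \<and>
      \<bar>int (position k i) - int (position k j)\<bar> \<le> 4 * int n * int n ^ l - 4"
  using assms
proof (induction k arbitrary: i j)
  case 0
  then show ?case by (auto split: if_splits)
next
  case (Suc k)
  define q r q' r' where "q = i div base" and "r = i mod base" and "q' = j div base" and "r' = j mod base"
  have ij: "int i = int q * int base + int r" "int j = int q' * int base + int r'"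
    by (simp_all add: q_def r_def q'_def r'_def flip: of_nat_mult of_nat_add)
  have lt: "r < base" "r' < base" using base_pos by (auto simp: r_def r'_def)
  have ev: "even r" "even r'" and h: "height k q \<noteq> 0" "height k q' \<noteq> 0"
    using height_neq_0_even[OF Suc.prems(1)] height_neq_0_even[OF Suc.prems(2)] even_base
    by (simp_all add: q_def r_def q'_def r'_def dvd_mod_iff del: height.simps)
  have le: "r + 2 \<le> base" "r' + 2 \<le> base"
    using lt ev even_base by presburger+
  have off: "offset r \<le> 2 * n - 2" "offset r' \<le> 2 * n - 2" using lt by (auto intro: offset_le)
  have pos: "int (position (Suc k) i) - int (position (Suc k) j)
      = int n * (int (position k q) - int (position k q')) + (int (offset r) - int (offset r'))"
    by (simp add: q_def r_def q'_def r'_def algebra_simps)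
  have offd: "\<bar>int (offset r) - int (offset r')\<bar> \<le> 2 * int n - 2" using off n_ge_2 by linarith
  show ?case
  proof (cases "q = q'")
    case True
    then have "r \<noteq> r'" using Suc.prems(3) ij by auto
    then have "2 \<le> \<bar>int r - int r'\<bar>" using ev by presburger
    then have "int base ^ 0 + 1 \<le> \<bar>int i - int j\<bar>" using ij True by simp
    moreover have "\<bar>int (position (Suc k) i) - int (position (Suc k) j)\<bar> \<le> 4 * int n * int n ^ 0 - 4"
      unfolding pos using True offd n_ge_2 by simp
    ultimately show ?thesis by blast
  next
    case False
    from Suc.IH[OF h False] obtain l where l: "l < k" "int base ^ l + 1 \<le> \<bar>int q - int q'\<bar>"
      "\<bar>int (position k q) - int (position k q')\<bar> \<le> 4 * int n * int n ^ l - 4" by blast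
    have "(int base ^ l + 1) * int base \<le> \<bar>int q - int q'\<bar> * int base"
      using l(2) by (rule mult_right_mono) simp
    also have "\<dots> = \<bar>(int q - int q') * int base\<bar>" by (simp add: abs_mult)
    also have "\<dots> = \<bar>(int i - int j) - (int r - int r')\<bar>" unfolding ij by (simp add: algebra_simps)
    finally have "int base ^ Suc l + 1 \<le> \<bar>int i - int j\<bar>" using le by (simp add: algebra_simps)
    moreover have "\<bar>int (position (Suc k) i) - int (position (Suc k) j)\<bar> \<le> 4 * int n * int n ^ Suc l - 4"
    proof -
      have "int n * \<bar>int (position k q) - int (position k q')\<bar> \<le> int n * (4 * int n * int n ^ l - 4)"
        using l(3) by (rule mult_left_mono) simp
      then have "\<bar>int n * (int (position k q) - int (position k q'))\<bar> \<le> 4 * int n * int n ^ Suc l - 4 * int n"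
        unfolding abs_mult by (simp add: algebra_simps)
      then show ?thesis unfolding pos using offd n_ge_2 by linarith
    qed
    ultimately show ?thesis using l(1) by (intro exI[of _ "Suc l"]) simp
  qed
qed

text \<open>The digit \<open>0\<close> is active and has offset \<open>0\<close>. So the left endpoint of an active time interval is
  also that of an active one at each later level, with the same place.\<close>

lemma position_extend: "position (k + m) (i * base ^ m) = n ^ m * position k i"
proof (induction m)
  case (Suc m)
  have "i * base ^ Suc m = i * base ^ m * base" by simp
  then show ?case using Suc base_pos by (simp add: offset_def)
qed simp

lemma height_extend: "height (k + m) (i * base ^ m) = height k i * (1 / (2 * real n)) ^ m"
proof (induction m)
  case (Suc m)
  have "i * base ^ Suc m = i * base ^ m * base" by simp
  then show ?case using Suc base_pos even_base by simp
qed simp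

lemma position_holder_same_level:
  assumes \<alpha>: "0 < \<alpha>" "real base powr \<alpha> \<le> real n"
    and h: "height k i \<noteq> 0" "height k j \<noteq> 0"
  shows "\<bar>real (position k i) / real n ^ k - real (position k j) / real n ^ k\<bar>
    \<le> 4 * real n * \<bar>real i / real base ^ k - real j / real base ^ k\<bar> powr \<alpha>"
proof (cases "i = j")
  case False
  from position_separation[OF h this] obtain l where l: "l < k"
    and sep: "int base ^ l + 1 \<le> \<bar>int i - int j\<bar>"
    and close: "\<bar>int (position k i) - int (position k j)\<bar> \<le> 4 * int n * int n ^ l - 4" by blast
  define b where "b = real base powr \<alpha>"
  have b: "0 < b" "b \<le> real n" using \<alpha> base_pos by (auto simp: b_def)
  have n: "real n > 0" and B: "real base > 0" using n_ge_2 base_pos by auto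
  have "real_of_int \<bar>int (position k i) - int (position k j)\<bar> \<le> real_of_int (4 * int n * int n ^ l)"
    using close by linarith
  then have "\<bar>real (position k i) - real (position k j)\<bar> \<le> 4 * real n * real n ^ l"
    by simp
  then have "\<bar>real (position k i) / real n ^ k - real (position k j) / real n ^ k\<bar> \<le> 4 * real n * (real n ^ l / real n ^ k)"
    using n by (simp add: diff_divide_distrib[symmetric] divide_right_mono)
  also have "real n ^ l / real n ^ k = 1 / real n ^ (k - l)"
    using l n by (simp add: power_diff)
  also have "\<dots> \<le> 1 / b ^ (k - l)"
    using b n by (intro divide_left_mono power_mono) auto
  also have "\<dots> = b ^ l / b ^ k"
    using l b by (simp add: power_diff)
  also have "\<dots> = (real base ^ l / real base ^ k) powr \<alpha>"
    using B by (simp add: b_def powr_divide powr_power powr_realpow[symmetric] powr_powr mult.commute)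
  also have "\<dots> \<le> \<bar>real i / real base ^ k - real j / real base ^ k\<bar> powr \<alpha>"
  proof (rule powr_mono2)
    have "real_of_int (int base ^ l) \<le> real_of_int \<bar>int i - int j\<bar>" using sep by linarith
    then have "real base ^ l \<le> \<bar>real i - real j\<bar>" by simp
    then show "real base ^ l / real base ^ k \<le> \<bar>real i / real base ^ k - real j / real base ^ k\<bar>"
      using B by (simp add: diff_divide_distrib[symmetric] divide_right_mono)
  qed (use \<alpha> B in auto)
  finally show ?thesis using n by (simp add: mult_left_mono)
qed (use \<alpha> in auto)

lemma position_holder:
  assumes \<alpha>: "0 < \<alpha>" "real base powr \<alpha> \<le> real n"
    and h: "height k i \<noteq> 0" "height m j \<noteq> 0"
  shows "\<bar>real (position k i) / real n ^ k - real (position m j) / real n ^ m\<bar>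
    \<le> 4 * real n * \<bar>real i / real base ^ k - real j / real base ^ m\<bar> powr \<alpha>"
proof -
  have "height (k + m) (i * base ^ m) \<noteq> 0" "height (k + m) (j * base ^ k) \<noteq> 0"
    using height_extend[of k m i] height_extend[of m k j] h n_ge_2 by (auto simp: add.commute)
  from position_holder_same_level[OF \<alpha> this] show ?thesis
    using position_extend[of k m i] position_extend[of m k j] n_ge_2 base_pos
    by (simp add: add.commute power_add field_simps)
qed

text \<open>It suffices to prescribe \<open>f\<close> at the left endpoints of the active time intervals, which are dense
  in the Cantor set.\<close>

lemma holder_function:
  assumes \<alpha>: "0 < \<alpha>" "\<alpha> \<le> 1" "real base powr \<alpha> \<le> real n"
  obtains f where "\<And>x y. \<bar>f x - f y\<bar> \<le> 4 * real n * \<bar>x - y\<bar> powr \<alpha>"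
    "\<And>k i. height k i \<noteq> 0 \<Longrightarrow> f (real i / real base ^ k) = real (position k i) / real n ^ k"
proof (rule holder_extension[of \<alpha> "4 * real n" "{(k, i). height k i \<noteq> 0}"
        "\<lambda>(k, i). real (position k i) / real n ^ k" "\<lambda>(k, i). real i / real base ^ k"])
  fix f
  assume "\<And>x y. \<bar>f x - f y\<bar> \<le> 4 * real n * \<bar>x - y\<bar> powr \<alpha>"
    "\<And>p. p \<in> {(k, i). height k i \<noteq> 0} \<Longrightarrow>
      f (case p of (k, i) \<Rightarrow> real i / real base ^ k) = (case p of (k, i) \<Rightarrow> real (position k i) / real n ^ k)"
  then show thesis by (intro that[of f]) force+
qed (use \<alpha> position_holder in auto)


text \<open>The case \<open>0 \<le> x \<le> 1\<close>: every hat of level \<open>k\<close> that is added at a time close to \<open>x\<close> has a support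
  close to \<open>f x\<close>, hence away from \<open>y\<close> if \<open>k\<close> is large.\<close>

lemma gain_locally_partial:
  assumes \<alpha>: "0 < \<alpha>" "\<alpha> \<le> 1" "real base powr \<alpha> \<le> real n"
    and hol: "\<And>x y. \<bar>f x - f y\<bar> \<le> 4 * real n * \<bar>x - y\<bar> powr \<alpha>"
    and val: "\<And>k i. height k i \<noteq> 0 \<Longrightarrow> f (real i / real base ^ k) = real (position k i) / real n ^ k"
    and off: "x \<in> {0..1} \<Longrightarrow> y \<noteq> f x"
  shows "\<exists>e>0. \<exists>k i. \<forall>x' y'. \<bar>x' - x\<bar> < e \<longrightarrow> \<bar>y' - y\<bar> < e \<longrightarrow> gain x' y' = partial k i y'"
proof -
  consider "x < 0" | "x > 1" | "x \<in> {0..1}" by fastforce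
  then show ?thesis
  proof cases
    case 1
    then have "\<forall>x' y'. \<bar>x' - x\<bar> < - x \<longrightarrow> \<bar>y' - y\<bar> < - x \<longrightarrow> gain x' y' = partial 0 0 y'"
      by (auto simp: gain_nonpos)
    then show ?thesis using 1 by (intro exI[of _ "- x"] conjI exI[of _ 0]) auto
  next
    case 2
    then have "\<forall>x' y'. \<bar>x' - x\<bar> < x - 1 \<longrightarrow> \<bar>y' - y\<bar> < x - 1 \<longrightarrow> gain x' y' = partial 0 1 y'"
      by (auto simp: gain_ge_1 partial_0_1 simp del: One_nat_def)
    then show ?thesis using 2 by (intro exI[of _ "x - 1"] conjI exI[of _ 0] exI[of _ 1]) auto
  next
    case 3
    define d where "d = \<bar>y - f x\<bar>"
    define b where "b = real base powr \<alpha>"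
    define C where "C = 8 * real n + 2"
    have d: "d > 0" using off[OF 3] by (simp add: d_def)
    have B: "real base > 1" using base_ge_2 by simp
    have b: "1 < b" "b \<le> real n" using \<alpha> B by (auto simp: b_def)
    have C: "C > 0" by (simp add: C_def)
    have "1 / b < 1" using b by simp
    then obtain k where k: "(1 / b) ^ k < d / (2 * C)"
      using real_arch_pow_inv[of "d / (2 * C)" "1 / b"] d C by auto
    define e where "e = min (1 / real base ^ k) (d / 2)"
    have e: "e > 0" using B d by (simp add: e_def)
    define i where "i = nat \<lfloor>real base ^ k * x\<rfloor>"
    have i: "real i \<le> real base ^ k * x" "real base ^ k * x < real i + 1"
      using 3 B by (simp_all add: i_def)
    \<comment> \<open>No hat of level \<open>k\<close> that is added near the time \<open>x\<close> is visible near \<open>y\<close>. The constant \<open>C\<close>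
      collects \<open>2\<close> from the width of the hat and \<open>4 * n * 2\<close> from the Hoelder bound for \<open>f\<close>.\<close>
    have zero: "bump k j y' = 0" if y': "\<bar>y' - y\<bar> < e" and j: "\<bar>real j - real base ^ k * x\<bar> \<le> 2" for j y'
    proof (rule ccontr)
      assume "bump k j y' \<noteq> 0"
      then have h: "height k j \<noteq> 0" and "hat (real n ^ k * y' - real (position k j)) \<noteq> 0"
        by (auto simp: bump_def)
      then have "\<not> (real n ^ k * y' - real (position k j) \<le> 0 \<or> 2 \<le> real n ^ k * y' - real (position k j))"
        using hat_eq_0 by metis
      then have "\<bar>real n ^ k * y' - real (position k j)\<bar> \<le> 2" by linarith
      moreover have "\<bar>y' - real (position k j) / real n ^ k\<bar> = \<bar>real n ^ k * y' - real (position k j)\<bar> / real n ^ k"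
      proof -
        have "y' - real (position k j) / real n ^ k = (real n ^ k * y' - real (position k j)) / real n ^ k"
          using n_ge_2 by (simp add: diff_divide_distrib)
        then show ?thesis by (simp add: abs_divide)
      qed
      ultimately have "\<bar>y' - real (position k j) / real n ^ k\<bar> \<le> 2 / real n ^ k"
        using n_ge_2 by (simp add: divide_right_mono)
      also have "\<dots> \<le> 2 / b ^ k" using b by (intro divide_left_mono power_mono) auto
      finally have 1: "\<bar>y' - f (real j / real base ^ k)\<bar> \<le> 2 * (1 / b) ^ k"
        by (simp add: val[OF h] power_divide)
      have "\<bar>x - real j / real base ^ k\<bar> = \<bar>real j - real base ^ k * x\<bar> / real base ^ k"
      proof -
        have "x - real j / real base ^ k = (real base ^ k * x - real j) / real base ^ k"
          using B by (simp add: diff_divide_distrib)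
        then show ?thesis by (simp add: abs_divide abs_minus_commute)
      qed
      also have "\<dots> \<le> 2 / real base ^ k" using j B by (simp add: divide_right_mono)
      finally have "\<bar>x - real j / real base ^ k\<bar> powr \<alpha> \<le> (2 / real base ^ k) powr \<alpha>"
        using \<alpha> by (intro powr_mono2) auto
      also have "\<dots> = 2 powr \<alpha> * (1 / b) ^ k"
        using B by (simp add: b_def powr_divide power_divide powr_power powr_realpow[symmetric] powr_powr mult.commute)
      also have "\<dots> \<le> 2 * (1 / b) ^ k"
        using powr_mono[of \<alpha> 1 2] \<alpha> b by (intro mult_right_mono) auto
      finally have "4 * real n * \<bar>x - real j / real base ^ k\<bar> powr \<alpha> \<le> 4 * real n * (2 * (1 / b) ^ k)"
        by (rule mult_left_mono) simp
      with hol[of x "real j / real base ^ k"]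
      have 2: "\<bar>f x - f (real j / real base ^ k)\<bar> \<le> 8 * real n * (1 / b) ^ k" by simp
      have "d \<le> \<bar>y' - y\<bar> + \<bar>y' - f (real j / real base ^ k)\<bar> + \<bar>f x - f (real j / real base ^ k)\<bar>"
        unfolding d_def by linarith
      also have "\<dots> < d / 2 + C * (1 / b) ^ k"
        using 1 2 y' by (simp add: e_def C_def algebra_simps)
      also have "\<dots> < d" using k C by (simp add: field_simps)
      finally show False .
    qed
    have "gain x' y' = partial k i y'" if x': "\<bar>x' - x\<bar> < e" and y': "\<bar>y' - y\<bar> < e" for x' y'
    proof -
      have "\<bar>x' - x\<bar> < 1 / real base ^ k" using x' by (simp add: e_def)
      then have "real base ^ k * \<bar>x' - x\<bar> < 1" using B by (simp add: field_simps)
      then have "\<bar>real base ^ k * x' - real base ^ k * x\<bar> < 1"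
        using B by (simp add: abs_mult flip: right_diff_distrib)
      then have lo: "real base ^ k * x - 1 < real base ^ k * x'" and hi: "real base ^ k * x' < real base ^ k * x + 1"
        by linarith+
      have mx: "real base ^ k * max 0 x' = max 0 (real base ^ k * x')"
        using B by (simp add: max_mult_distrib_left)
      have i0: "bump k i y' = 0" using i by (intro zero[OF y']) linarith
      have i1: "bump k (Suc i) y' = 0" using i by (intro zero[OF y']) (simp add: abs_le_iff)
      show ?thesis
      proof (cases "real i \<le> max 0 (real base ^ k * x')")
        case True
        have "gain x' y' \<le> partial k (Suc (Suc i)) y'"
          using hi i by (intro gain_le) (simp add: mx)
        moreover have "partial k i y' \<le> gain x' y'" using True by (intro gain_ge) (simp add: mx)
        ultimately show ?thesis using i0 i1 by (simp add: partial_Suc)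
      next
        case False
        then obtain i' where i': "i = Suc i'" by (cases i) auto
        have "bump k i' y' = 0" using i i' by (intro zero[OF y']) (simp add: abs_le_iff)
        moreover have "gain x' y' \<le> partial k i y'" using False by (intro gain_le) (simp add: mx)
        moreover have "partial k i' y' \<le> gain x' y'"
          using lo i i' by (intro gain_ge) (simp add: mx)
        ultimately show ?thesis by (simp add: i' partial_Suc)
      qed
    qed
    then show ?thesis using e by (intro exI[of _ e] conjI exI[of _ k] exI[of _ i]) auto
  qed
qed

section \<open>Quasiconformality off the graph\<close>

text \<open>The kinks of the hats of all levels are at rational heights.\<close>

lemma has_derivative_shear:
  assumes "snd p \<notin> \<rat>" "e > 0"
    and loc: "\<And>x y. \<bar>x - fst p\<bar> < e \<Longrightarrow> \<bar>y - snd p\<bar> < e \<Longrightarrow> gain x y = partial k i y"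
  obtains D where "\<bar>D\<bar> \<le> 2 * real base" "(shear has_derivative (\<lambda>h. (fst h + D * snd h, snd h))) (at p)"
proof -
  have "partial k i differentiable (at (snd p))" by (rule partial_differentiable) fact
  then obtain D where D: "(partial k i has_real_derivative D) (at (snd p))"
    by (auto simp: real_differentiable_def)
  have "\<bar>D\<bar> \<le> 2 * real base"
  proof (rule tendsto_upperbound)
    show "((\<lambda>h. \<bar>(partial k i (snd p + h) - partial k i (snd p)) / h\<bar>) \<longlongrightarrow> \<bar>D\<bar>) (at 0)"
      using D by (intro tendsto_rabs) (simp add: DERIV_def)
    show "\<forall>\<^sub>F h in at 0. \<bar>(partial k i (snd p + h) - partial k i (snd p)) / h\<bar> \<le> 2 * real base"
      using partial_lipschitz[of k i "snd p + _" "snd p"]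
      by (auto simp: eventually_at_filter divide_le_eq)
  qed simp
  moreover have "(shear has_derivative (\<lambda>h. (fst h + D * snd h, snd h))) (at p)"
  proof (rule has_derivative_transform_within_open)
    show "((\<lambda>q. (fst q + partial k i (snd q), snd q)) has_derivative (\<lambda>h. (fst h + D * snd h, snd h))) (at p)"
    proof -
      have snd: "(snd has_derivative snd) (at p)" and fst: "(fst has_derivative fst) (at p)"
        by (simp_all add: bounded_linear_imp_has_derivative bounded_linear_snd bounded_linear_fst)
      have "((\<lambda>q. partial k i (snd q)) has_derivative (\<lambda>h. D * snd h)) (at p)"
        using snd D unfolding has_field_derivative_def
        by (rule has_derivative_compose[of snd snd p UNIV "partial k i" "(*) D"])
      from has_derivative_Pair[OF has_derivative_add[OF fst this] snd] show ?thesis .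
    qed
    show "open ({fst p - e<..<fst p + e} \<times> {snd p - e<..<snd p + e})" by (intro open_Times) auto
    show "p \<in> {fst p - e<..<fst p + e} \<times> {snd p - e<..<snd p + e}" using \<open>e > 0\<close> by (cases p) auto
    fix q assume "q \<in> {fst p - e<..<fst p + e} \<times> {snd p - e<..<snd p + e}"
    then show "(fst q + partial k i (snd q), snd q) = shear q"
      by (auto simp: shear_def loc abs_less_iff)
  qed
  ultimately show ?thesis by (rule that)
qed

lemma norm_shear_derivative:
  assumes D: "\<bar>D\<bar> \<le> L"
  shows "norm (cos \<theta> + D * sin \<theta>, sin \<theta>) \<le> 2 + L" "1 / (2 + L) \<le> norm (cos \<theta> + D * sin \<theta>, sin \<theta>)"
proof -
  let ?m = "norm (cos \<theta> + D * sin \<theta>, sin \<theta>)"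
  have L: "0 \<le> L" using D by simp
  have "?m \<le> \<bar>cos \<theta> + D * sin \<theta>\<bar> + \<bar>sin \<theta>\<bar>"
    unfolding norm_Pair by (simp add: sqrt_sum_squares_le_sum_abs)
  also have "\<dots> \<le> \<bar>cos \<theta>\<bar> + \<bar>D * sin \<theta>\<bar> + \<bar>sin \<theta>\<bar>" by linarith
  also have "\<bar>D * sin \<theta>\<bar> \<le> L * 1" unfolding abs_mult using D by (intro mult_mono) auto
  finally show "?m \<le> 2 + L" using abs_cos_le_one[of \<theta>] abs_sin_le_one[of \<theta>] by linarith
  have s: "\<bar>sin \<theta>\<bar> \<le> ?m" and c: "\<bar>cos \<theta> + D * sin \<theta>\<bar> \<le> ?m"
    using norm_snd_le[of "sin \<theta>" "cos \<theta> + D * sin \<theta>"] norm_fst_le[of "cos \<theta> + D * sin \<theta>" "sin \<theta>"] by simp_all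
  have "\<bar>D * sin \<theta>\<bar> \<le> L * ?m" unfolding abs_mult using D s L by (intro mult_mono) auto
  with c have c': "\<bar>cos \<theta>\<bar> \<le> ?m + L * ?m" by linarith
  have "1 = \<bar>cos \<theta>\<bar> * \<bar>cos \<theta>\<bar> + \<bar>sin \<theta>\<bar> * \<bar>sin \<theta>\<bar>"
    using sin_cos_squared_add[of \<theta>] by (simp add: power2_eq_square)
  also have "\<dots> \<le> \<bar>cos \<theta>\<bar> * 1 + \<bar>sin \<theta>\<bar> * 1" by (intro add_mono mult_left_mono) auto
  finally have "1 \<le> (2 + L) * ?m" using s c' by (simp add: algebra_simps)
  then show "1 / (2 + L) \<le> ?m" using L by (simp add: field_simps)
qed

lemma quasiconformal_shear:
  assumes "closed K"
    and loc: "\<And>p. p \<notin> K \<Longrightarrow> \<exists>e>0. \<exists>k i. \<forall>x y. \<bar>x - fst p\<bar> < e \<longrightarrow> \<bar>y - snd p\<bar> < e \<longrightarrow> gain x y = partial k i y"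
  shows "quasiconformal (- K) (shear ` (- K)) shear"
  unfolding quasiconformal_def
proof (intro conjI)
  have cont: "continuous_on (- K) shear" and inj: "inj_on shear (- K)"
    using continuous_on_subset[OF continuous_on_shear] inj_on_subset[OF inj_shear] by auto
  show op: "open (- K)" using assms by auto
  show "open (shear ` (- K))" using cont op inj by (rule invariance_of_domain)
  show "\<exists>g. homeomorphism (- K) (shear ` (- K)) shear g"
    using invariance_of_domain_homeomorphism[OF op cont _ inj] by auto
  have horizontal: "absolutely_continuous_on {a..b} (\<lambda>x. shear (x, y))" if "{a..b} \<times> {y} \<subseteq> - K" for a b y
  proof -
    have "(\<lambda>x. gain x y) constant_on {a..b}"
    proof (rule locally_constant_imp_constant)
      fix x assume x: "x \<in> {a..b}"
      then have "(x, y) \<in> {a..b} \<times> {y}" by simp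
      then have "(x, y) \<notin> K" using that by blast
      from loc[OF this] obtain e k i where e: "e > 0"
        and eq: "\<And>x' y'. \<bar>x' - x\<bar> < e \<Longrightarrow> \<bar>y' - y\<bar> < e \<Longrightarrow> gain x' y' = partial k i y'" by auto
      have "\<forall>x'\<in>{a..b} \<inter> ball x e. gain x' y = gain x y"
        using eq[of _ y] e by (auto simp: dist_real_def abs_minus_commute)
      moreover have "openin (top_of_set {a..b}) ({a..b} \<inter> ball x e)"
        by (intro openin_open_Int open_ball)
      moreover have "x \<in> {a..b} \<inter> ball x e" using x e by simp
      ultimately show "\<exists>T. openin (top_of_set {a..b}) T \<and> x \<in> T \<and> (\<forall>x'\<in>T. gain x' y = gain x y)"
        by blast
    qed (rule connected_Icc)
    then obtain c where "\<And>x. x \<in> {a..b} \<Longrightarrow> gain x y = c" unfolding constant_on_def by blast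
    then show ?thesis
      by (intro lipschitz_imp_absolutely_continuous_on[of _ _ 1])
         (simp add: shear_def dist_prod_def dist_real_def)
  qed
  have vertical: "absolutely_continuous_on {a..b} (\<lambda>y. shear (x, y))" for a b x
  proof (rule lipschitz_imp_absolutely_continuous_on)
    fix y z
    have "dist (shear (x, y)) (shear (x, z)) \<le> \<bar>gain x y - gain x z\<bar> + \<bar>y - z\<bar>"
      using sqrt_sum_squares_le_sum_abs[of "gain x y - gain x z" "y - z"]
      by (simp add: shear_def dist_prod_def dist_real_def)
    also have "\<dots> \<le> (2 * real base + 1) * \<bar>y - z\<bar>"
      using gain_lipschitz[of x y z] by (simp add: algebra_simps)
    finally show "dist (shear (x, y)) (shear (x, z)) \<le> (2 * real base + 1) * \<bar>y - z\<bar>" .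
  qed
  show "ACL_on (- K) shear"
    unfolding ACL_on_def using horizontal vertical by auto
  have "negligible (\<Union>q\<in>\<rat>. {p :: real \<times> real. (0, 1) \<bullet> p = q})"
  proof (rule negligible_countable_Union)
    show "countable ((\<lambda>q. {p :: real \<times> real. (0, 1) \<bullet> p = q}) ` \<rat>)"
      by (intro countable_image countable_rat)
    fix S assume "S \<in> (\<lambda>q. {p :: real \<times> real. (0, 1) \<bullet> p = q}) ` \<rat>"
    then obtain q where "S = {p :: real \<times> real. (0, 1) \<bullet> p = q}" by blast
    then show "negligible S" by (simp add: negligible_hyperplane zero_prod_def)
  qed
  moreover have "(\<Union>q\<in>\<rat>. {p :: real \<times> real. (0, 1) \<bullet> p = q}) = {p. snd p \<in> \<rat>}"
    by auto
  ultimately have "AE p::real \<times> real in lebesgue. p \<notin> {p. snd p \<in> \<rat>}"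
    by (intro AE_not_in) (simp add: negligible_iff_null_sets)
  then have irrational: "AE p::real \<times> real in lebesgue. snd p \<notin> \<rat>" by simp
  have deriv: "\<exists>D. \<bar>D\<bar> \<le> 2 * real base \<and> (shear has_derivative (\<lambda>h. (fst h + D * snd h, snd h))) (at p)"
    if "p \<in> - K" "snd p \<notin> \<rat>" for p
  proof -
    from loc[of p] that obtain e k i where "e > 0"
      "\<And>x y. \<bar>x - fst p\<bar> < e \<Longrightarrow> \<bar>y - snd p\<bar> < e \<Longrightarrow> gain x y = partial k i y" by auto
    from has_derivative_shear[OF that(2) this] show ?thesis by blast
  qed
  show "AE p in lebesgue. p \<in> - K \<longrightarrow> shear differentiable (at p)"
    by (rule eventually_mono[OF irrational]) (use deriv in \<open>unfold differentiable_def, blast\<close>)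
  show "\<exists>C. AE p in lebesgue. p \<in> - K \<longrightarrow>
        (SUP \<theta>. norm (dir_deriv \<theta> shear p)) \<le> C * (INF \<theta>. norm (dir_deriv \<theta> shear p))"
  proof (intro exI eventually_mono[OF irrational] impI)
    fix p assume "snd p \<notin> \<rat>" "p \<in> - K"
    from deriv[OF this(2,1)] obtain D where D: "\<bar>D\<bar> \<le> 2 * real base"
      "(shear has_derivative (\<lambda>h. (fst h + D * snd h, snd h))) (at p)" by blast
    define M where "M = 2 + 2 * real base"
    have M: "M > 0" by (simp add: M_def)
    have dir: "dir_deriv \<theta> shear p = (cos \<theta> + D * sin \<theta>, sin \<theta>)" for \<theta>
      using dir_deriv_eq[OF D(2)] by simp
    have "(SUP \<theta>. norm (dir_deriv \<theta> shear p)) \<le> M"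
      unfolding dir M_def by (intro cSUP_least norm_shear_derivative D) auto
    also have "M = (M * M) * (1 / M)" using M by simp
    also have "\<dots> \<le> (M * M) * (INF \<theta>. norm (dir_deriv \<theta> shear p))"
      unfolding dir M_def by (intro mult_left_mono cINF_greatest norm_shear_derivative D) auto
    finally show "(SUP \<theta>. norm (dir_deriv \<theta> shear p))
        \<le> ((2 + 2 * real base) * (2 + 2 * real base)) * (INF \<theta>. norm (dir_deriv \<theta> shear p))"
      by (simp add: M_def)
  qed
qed

section \<open>Failure of absolute continuity\<close>

lemma sum_height: "(\<Sum>j<base ^ k. height k j) = real n ^ k"
proof (induction k)
  case (Suc k)
  have "(\<Sum>j<base ^ k * base. height (Suc k) j)
      = (\<Sum>q<base ^ k. \<Sum>r<base. height k q * (if even r then 1 / (2 * real n) else 0))"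
    unfolding sum_lessThan_mult using even_base by (intro sum.cong) auto
  also have "\<dots> = (\<Sum>q<base ^ k. height k q * real n)"
    using sum_digits[of "\<lambda>_. 1"] n_ge_2 by (simp flip: sum_distrib_left)
  finally show ?case using Suc by (simp add: mult.commute flip: sum_distrib_left)
qed simp

text \<open>The total length of the active time intervals of level \<open>k\<close>, obtained by dividing the sum of the
  heights by their common value.\<close>

lemma card_active: "real (card {j. j < base ^ k \<and> height k j \<noteq> 0}) / real base ^ k = (1 / 2) ^ k"
proof -
  define J where "J = {j. j < base ^ k \<and> height k j \<noteq> 0}"
  have n: "real n > 0" using n_ge_2 by simp
  have "real n ^ k = (\<Sum>j\<in>J. height k j)"
    unfolding sum_height[symmetric] by (rule sum.mono_neutral_right) (auto simp: J_def)
  also have "\<dots> = (\<Sum>j\<in>J. (1 / (2 * real n)) ^ k)"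
    using height_cases by (intro sum.cong) (auto simp: J_def)
  also have "\<dots> = real (card J) / (2 * real n) ^ k" by (simp add: power_divide)
  finally have "real (card J) = real n ^ k * (2 * real n) ^ k" using n by (simp add: field_simps)
  then have "real (card J) / real base ^ k = (real n * (2 * real n) / real base) ^ k"
    by (simp only: power_mult_distrib power_divide)
  also have "real n * (2 * real n) / real base = 1 / 2" using n by (simp add: base_def)
  finally show ?thesis by (simp add: J_def)
qed

text \<open>The active time intervals of level \<open>k\<close> have total length \<open>2 ^ -k\<close>, but \<open>gain\<close> increases from \<open>0\<close> to
  \<open>hat y\<close> on them.\<close>

lemma not_absolutely_continuous_shear:
  assumes y: "0 < hat y"
  shows "\<not> absolutely_continuous_on {0..1} (\<lambda>x. shear (x, y))"
proof
  assume "absolutely_continuous_on {0..1} (\<lambda>x. shear (x, y))"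
  from absolutely_continuous_on_def[THEN iffD1, THEN spec, THEN mp, OF this y]
  obtain \<delta> where \<delta>: "\<delta> > 0" and ac: "\<forall>D. finite D \<and> (\<forall>(u, v)\<in>D. u \<le> v \<and> {u..v} \<subseteq> {0..1}) \<and>
      pairwise (\<lambda>I J. disjnt {fst I<..<snd I} {fst J<..<snd J}) D \<and> (\<Sum>(u, v)\<in>D. v - u) < \<delta>
      \<longrightarrow> (\<Sum>(u, v)\<in>D. dist (shear (u, y)) (shear (v, y))) < hat y"
    by (elim exE conjE)
  obtain k where k: "(1 / 2) ^ k < \<delta>" using real_arch_pow_inv[of \<delta> "1 / 2"] \<delta> by auto
  have B: "real base ^ k > 0" using base_pos by simp
  define J where "J = {j. j < base ^ k \<and> height k j \<noteq> 0}"
  define I where "I j = (real j / real base ^ k, real (Suc j) / real base ^ k)" for j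
  have inj: "inj_on I J" using B by (auto simp: inj_on_def I_def)
  have sum_I: "(\<Sum>(u, v)\<in>I ` J. h u v) = (\<Sum>j\<in>J. h (real j / real base ^ k) (real (Suc j) / real base ^ k))"
    for h :: "real \<Rightarrow> real \<Rightarrow> real"
    by (simp only: sum.reindex[OF inj] o_def I_def case_prod_conv)
  have "(\<Sum>(u, v)\<in>I ` J. dist (shear (u, y)) (shear (v, y))) < hat y"
  proof (intro ac[THEN spec, THEN mp] conjI)
    show "finite (I ` J)" by (simp add: J_def)
    show "\<forall>(u, v)\<in>I ` J. u \<le> v \<and> {u..v} \<subseteq> {0..1}"
    proof clarify
      fix u v j assume uv: "(u, v) = I j" and "j \<in> J"
      then have "Suc j \<le> base ^ k" by (simp add: J_def)
      then have "real (Suc j) \<le> real (base ^ k)" by (simp only: of_nat_le_iff)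
      then have "real (Suc j) / real base ^ k \<le> 1" "0 \<le> real j / real base ^ k" using B by simp_all
      moreover have "u \<le> v" using uv B by (simp add: I_def divide_right_mono)
      ultimately show "u \<le> v \<and> {u..v} \<subseteq> {0..1}" using uv by (auto simp: I_def)
    qed
    show "pairwise (\<lambda>I J. disjnt {fst I<..<snd I} {fst J<..<snd J}) (I ` J)"
    proof (clarsimp simp: pairwise_def)
      fix i j assume "I i \<noteq> I j"
      then have "i \<noteq> j" by auto
      then have "Suc i \<le> j \<or> Suc j \<le> i" by linarith
      then have "real (Suc i) \<le> real j \<or> real (Suc j) \<le> real i" by (simp only: of_nat_le_iff)
      then have "snd (I i) \<le> fst (I j) \<or> snd (I j) \<le> fst (I i)"
        unfolding I_def fst_conv snd_conv divide_le_cancel using B by auto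
      then show "disjnt {fst (I i)<..<snd (I i)} {fst (I j)<..<snd (I j)}"
        by (auto simp: disjnt_def)
    qed
    have "(\<Sum>(u, v)\<in>I ` J. v - u) = real (card J) / real base ^ k"
      unfolding sum_I by (simp add: diff_divide_distrib[symmetric])
    then show "(\<Sum>(u, v)\<in>I ` J. v - u) < \<delta>" using k card_active[of k] by (simp add: J_def)
  qed
  moreover have "hat y \<le> (\<Sum>(u, v)\<in>I ` J. dist (shear (u, y)) (shear (v, y)))"
  proof -
    have "hat y = (\<Sum>j\<in>J. bump k j y)"
      unfolding partial_ge[OF order_refl, of k, symmetric] partial_def
      by (rule sum.mono_neutral_right) (auto simp: J_def bump_def)
    also have "\<dots> \<le> (\<Sum>j\<in>J. dist (shear (real j / real base ^ k, y)) (shear (real (Suc j) / real base ^ k, y)))"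
    proof (rule sum_mono)
      fix j
      let ?u = "real j / real base ^ k" and ?v = "real (Suc j) / real base ^ k"
      have "bump k j y = gain ?v y - gain ?u y" unfolding gain_eq_partial by (simp add: partial_Suc)
      also have "\<dots> \<le> (?v + gain ?v y) - (?u + gain ?u y)" using B by (simp add: divide_right_mono)
      also have "\<dots> \<le> dist (fst (shear (?u, y))) (fst (shear (?v, y)))"
        unfolding shear_def dist_real_def by simp
      also have "\<dots> \<le> dist (shear (?u, y)) (shear (?v, y))" by (rule dist_fst_le)
      finally show "bump k j y \<le> dist (shear (?u, y)) (shear (?v, y))" .
    qed
    finally show ?thesis unfolding sum_I .
  qed
  ultimately show False by simp
qed

lemma not_quasiconformal_shear: "\<not> quasiconformal UNIV UNIV shear"
proof
  assume "quasiconformal UNIV UNIV shear"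
  then have "AE y in lebesgue. \<forall>a b. a \<le> b \<and> {a..b} \<times> {y} \<subseteq> UNIV \<longrightarrow>
      absolutely_continuous_on {a..b} (\<lambda>x. shear (x, y))"
    by (simp add: quasiconformal_def ACL_on_def)
  then have "AE y in lebesgue. \<not> 0 < hat y"
    by eventually_elim (use not_absolutely_continuous_shear in force)
  then obtain N where N: "{y \<in> space lebesgue. \<not> \<not> 0 < hat y} \<subseteq> N" "emeasure lebesgue N = 0" "N \<in> sets lebesgue"
    by (rule AE_E)
  have "{0<..<2} \<subseteq> N" using N(1) by (auto simp: hat_def max_def)
  then have "emeasure lebesgue {0<..<2::real} \<le> emeasure lebesgue N"
    using N(3) by (rule emeasure_mono)
  then show False using N(2) by simp
qed

end

section \<open>Non-removable Hoelder graphs\<close>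

theorem theorem5:
  fixes \<alpha> :: real
  assumes "0 < \<alpha>" and "\<alpha> < 1 / 2"
  shows "\<exists>\<Gamma>. holder_graph \<alpha> \<Gamma> \<and> \<not> qc_removable \<Gamma>"
proof -
  \<comment> \<open>For \<open>n \<ge> m\<close> one has \<open>4 powr \<alpha> \<le> n powr (1 - 2 * \<alpha>)\<close>, that is, \<open>(4 * n\<^sup>2) powr \<alpha> \<le> n\<close>.\<close>
  define m where "m = 4 powr (\<alpha> / (1 - 2 * \<alpha>))"
  define n where "n = max 2 (nat \<lceil>m\<rceil>)"
  have n: "2 \<le> n" "m \<le> real n" using real_nat_ceiling_ge[of m] by (auto simp: n_def max_def)
  interpret refinement n by unfold_locales (rule n)
  have "real base powr \<alpha> = 4 powr \<alpha> * real n powr (2 * \<alpha>)"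
    using n by (simp add: base_def powr_mult powr_add[symmetric] mult.commute)
  also have "4 powr \<alpha> = m powr (1 - 2 * \<alpha>)" using assms by (simp add: m_def powr_powr)
  also have "\<dots> \<le> real n powr (1 - 2 * \<alpha>)"
    using assms n by (intro powr_mono2) (auto simp: m_def)
  also have "real n powr (1 - 2 * \<alpha>) * real n powr (2 * \<alpha>) = real n"
    using n by (simp add: powr_add[symmetric])
  finally have \<alpha>: "0 < \<alpha>" "\<alpha> \<le> 1" "real base powr \<alpha> \<le> real n" using assms by (auto simp: mult_right_mono)
  obtain f where hol: "\<And>x y. \<bar>f x - f y\<bar> \<le> 4 * real n * \<bar>x - y\<bar> powr \<alpha>"
    and val: "\<And>k i. height k i \<noteq> 0 \<Longrightarrow> f (real i / real base ^ k) = real (position k i) / real n ^ k"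
    using holder_function[OF \<alpha>] by blast
  define \<Gamma> where "\<Gamma> = (\<lambda>x. (x, f x)) ` {0..1}"
  have graph: "holder_graph \<alpha> \<Gamma>"
    unfolding holder_graph_def \<Gamma>_def using hol by blast
  then have "closed \<Gamma>" using assms compact_holder_graph compact_imp_closed by blast
  moreover have "\<exists>e>0. \<exists>k i. \<forall>x y. \<bar>x - fst p\<bar> < e \<longrightarrow> \<bar>y - snd p\<bar> < e \<longrightarrow> gain x y = partial k i y"
    if "p \<notin> \<Gamma>" for p
    by (rule gain_locally_partial[OF \<alpha> hol val]) (use that in \<open>auto simp: \<Gamma>_def image_iff prod_eq_iff\<close>)
  ultimately have "quasiconformal (- \<Gamma>) (shear ` (- \<Gamma>)) shear" by (rule quasiconformal_shear)
  moreover obtain g where "homeomorphism UNIV UNIV shear g" by (rule homeomorphism_shear)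
  ultimately have "\<not> qc_removable \<Gamma>"
    unfolding qc_removable_def using not_quasiconformal_shear by blast
  then show ?thesis using graph by blast
qed

end
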